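(* Let $R$ be a commutative unitary ring, and let $\mathcal{S}_R$ be the multiplicative semigroup of $R$. If $\textsc{I}(\mathcal{S}_R)$ is finite, then one of the following two conditions holds: (i) The ring $R$ is finite; (ii) The Jacobson radical $J(R)$ is finite and $R/J(R)\cong B\times\prod_{i=1}^t\mathbb{F}_{q_i}$, where $B$ is an infinite Boolean unitary ring, and $\mathbb{F}_{q_1},\ldots,\mathbb{F}_{q_t}$ are finite fields with $0\le t\le \textsc{I}(\mathcal{S}_R)-1$ and prime powers $q_1,\ldots,q_t>2$.
   Context: For a commutative semigroup $\mathcal{S}$, an idempotent is an element $e$ with $e*e=e$. The Erdős–Burgess constant $\textsc{I}(\mathcal{S})$ is the smallest positive integer $\ell$ (if it exists) such that every sequence of $\ell$ terms (not necessarily distinct) from $\mathcal{S}$ contains one or more terms whose product is an idempotent; if no such $\ell$ exists, $\textsc{I}(\mathcal{S})=\infty$. A Boolean ring is a ring in which every element is idempotent. *)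

theory Defs
  imports
    "HOL-Algebra.Algebra"
    "HOL-Library.Extended_Nat"
    "HOL-Library.Sublist"
    "HOL-Number_Theory.Prime_Powers"
begin

text \<open>
  A commutative semigroup is represented by the fields \<^const>\<open>carrier\<close> and \<^const>\<open>mult\<close> of a
  monoid record; none of the following definitions looks at its unit.  As a ring record extends
  a monoid record, a ring \<open>R\<close> itself plays the role of its multiplicative semigroup.
\<close>

definition idempotent_elem :: "('a, 'm) monoid_scheme \<Rightarrow> 'a \<Rightarrow> bool"
  where "idempotent_elem S e \<longleftrightarrow> e \<in> carrier S \<and> e \<otimes>\<^bsub>S\<^esub> e = e"

text \<open>
  The product of a nonempty list, that is \<open>x\<^sub>1 * (x\<^sub>2 * \<dots> * x\<^sub>n)\<close> with no trailing unit.
\<close>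

definition semigroup_prod :: "('a, 'm) monoid_scheme \<Rightarrow> 'a list \<Rightarrow> 'a"
  where "semigroup_prod S xs = foldr (\<otimes>\<^bsub>S\<^esub>) (butlast xs) (last xs)"

definition has_idempotent_product :: "('a, 'm) monoid_scheme \<Rightarrow> 'a list \<Rightarrow> bool"
  where "has_idempotent_product S xs \<longleftrightarrow>
    (\<exists>ys. ys \<noteq> [] \<and> subseq ys xs \<and> idempotent_elem S (semigroup_prod S ys))"

definition erdos_burgess_length :: "('a, 'm) monoid_scheme \<Rightarrow> nat \<Rightarrow> bool"
  where "erdos_burgess_length S l \<longleftrightarrow> 0 < l \<and>
    (\<forall>xs. set xs \<subseteq> carrier S \<and> length xs = l \<longrightarrow> has_idempotent_product S xs)"

definition erdos_burgess_constant :: "('a, 'm) monoid_scheme \<Rightarrow> enat"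
  where "erdos_burgess_constant S =
    (if \<exists>l. erdos_burgess_length S l then enat (LEAST l. erdos_burgess_length S l) else \<infinity>)"

text \<open>
  The intersection of all maximal ideals, taken inside the carrier; it is the whole ring for the
  zero ring, which has no maximal ideal.
\<close>

definition jacobson_radical :: "('a, 'm) ring_scheme \<Rightarrow> 'a set"
  where "jacobson_radical R = {x \<in> carrier R. \<forall>M. maximalideal M R \<longrightarrow> x \<in> M}"

locale boolean_ring = ring +
  assumes idempotent: "x \<in> carrier R \<Longrightarrow> idempotent_elem R x"

end

theory Submission
  imports Defs
begin

text \<open>
  If every sequence of length \<open>l\<close> has an idempotent subproduct, then so does every sequence of
  units; as 1 is the only idempotent unit, greedily prolonging a sequence without subproduct 1
  shows that there are finitely many units. Since \<open>1 + J(R)\<close> consists of units, \<open>J(R)\<close> is finite,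
  and since every element is congruent to 0 or to a unit modulo a given maximal ideal, the residue
  fields are finite. By the Chinese remainder theorem, \<open>t\<close> maximal ideals with more than two
  residues yield a sequence of length \<open>t\<close> without idempotent subproduct, so there are fewer than
  \<open>l\<close> of them. Modulo the intersection \<open>K\<close> of the remaining maximal ideals, \<open>R\<close> is Boolean, and
  \<open>K\<close> is coprime to each exceptional ideal \<open>M\<close>: if \<open>u\<close> is a unit that is not 1 modulo \<open>M\<close>, then
  \<open>1 - u\<close> lies in \<open>K\<close> but not in \<open>M\<close>.
\<close>

section \<open>Subproducts of sequences in a monoid\<close>

lemma (in monoid) foldr_mult_closed:
  assumes "set xs \<subseteq> carrier G"
  shows "foldr (\<otimes>) xs \<one> \<in> carrier G"
  using assms by (induction xs) auto

text \<open>In a monoid the trailing unit is harmless, and the \<open>foldr\<close> form is the one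
  that suits induction on lists.\<close>

lemma (in monoid) semigroup_prod_eq_foldr:
  assumes "set xs \<subseteq> carrier G" "xs \<noteq> []"
  shows "semigroup_prod G xs = foldr (\<otimes>) xs \<one>"
  using assms(2,1)
proof (induction xs rule: list_nonempty_induct)
  case (single x)
  then show ?case by (simp add: semigroup_prod_def)
next
  case (cons x xs)
  then have "semigroup_prod G xs = foldr (\<otimes>) xs \<one>" by simp
  with cons.hyps show ?case by (simp add: semigroup_prod_def)
qed

lemma subseq_set: "subseq ys xs \<Longrightarrow> set ys \<subseteq> set xs"
  using set_nths_subset by (fastforce simp: subseq_conv_nths)

lemma (in monoid) erdos_burgess_lengthE:
  assumes "erdos_burgess_length G l" "set xs \<subseteq> carrier G" "length xs = l"
  obtains ys where "ys \<noteq> []" "subseq ys xs" "set ys \<subseteq> carrier G"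
    "idempotent_elem G (foldr (\<otimes>) ys \<one>)"
proof -
  obtain ys where ys: "ys \<noteq> []" "subseq ys xs" "idempotent_elem G (semigroup_prod G ys)"
    using assms unfolding erdos_burgess_length_def has_idempotent_product_def by blast
  moreover have "set ys \<subseteq> carrier G"
    using subseq_set[OF ys(2)] assms(2) by blast
  ultimately show ?thesis
    using that semigroup_prod_eq_foldr by metis
qed

lemma (in monoid) foldr_mult_replicate:
  assumes "x \<in> carrier G"
  shows "foldr (\<otimes>) (replicate k x) \<one> = x [^] k"
proof (induction k)
  case (Suc k)
  then show ?case using assms nat_pow_Suc2[OF assms] by simp
qed simp

text \<open>Apply the length property to the constant sequence \<open>x, ..., x\<close>: its
  nonempty subproducts are the positive powers of \<open>x\<close>.\<close>

lemma (in monoid) erdos_burgess_idempotent_pow: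
  assumes "erdos_burgess_length G l" "x \<in> carrier G"
  obtains k where "0 < k" "idempotent_elem G (x [^] (k::nat))"
proof -
  have "set (replicate l x) \<subseteq> carrier G" using assms(2) by auto
  then obtain ys where ys: "ys \<noteq> []" "subseq ys (replicate l x)"
      "idempotent_elem G (foldr (\<otimes>) ys \<one>)"
    using assms(1) erdos_burgess_lengthE length_replicate by metis
  have "set ys \<subseteq> {x}"
    using subseq_set[OF ys(2)] by (auto split: if_splits)
  then have "ys = replicate (length ys) x"
    by (metis replicate_eqI singletonD subsetD)
  then have "idempotent_elem G (x [^] length ys)"
    using ys(3) foldr_mult_replicate[OF assms(2)] by metis
  with ys(1) show ?thesis using that by blast
qed

section \<open>Finiteness of the group of units\<close>

lemma (in monoid) unit_idempotent_eq_one: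
  assumes "x \<in> Units G" "idempotent_elem G x"
  shows "x = \<one>"
  using assms unfolding idempotent_elem_def
  by (metis Units_l_cancel one_closed r_one)

lemma (in monoid) foldr_mult_Units:
  assumes "set xs \<subseteq> Units G"
  shows "foldr (\<otimes>) xs \<one> \<in> Units G"
  using assms by (induction xs) auto

text \<open>A unit can be prepended unless it is the inverse of a subproduct of \<open>xs\<close>,
  which excludes only finitely many candidates.\<close>

lemma (in monoid) infinite_Units_product_one_free:
  assumes "infinite (Units G)"
  shows "\<exists>xs. set xs \<subseteq> Units G \<and> length xs = n \<and>
    (\<forall>ys. subseq ys xs \<and> ys \<noteq> [] \<longrightarrow> foldr (\<otimes>) ys \<one> \<noteq> \<one>)"
proof (induction n)
  case 0
  show ?case by (intro exI[of _ "[]"]) auto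
next
  case (Suc n)
  then obtain xs where xs: "set xs \<subseteq> Units G" "length xs = n"
      "\<And>ys. subseq ys xs \<Longrightarrow> ys \<noteq> [] \<Longrightarrow> foldr (\<otimes>) ys \<one> \<noteq> \<one>" by blast
  \<comment> \<open>The empty subsequence counts here: it puts \<open>\<one>\<close> into
    \<open>P\<close>, so that \<open>g\<close> alone is not a product equal to \<open>\<one>\<close>
    either.\<close>
  define P where "P = (\<lambda>ys. inv (foldr (\<otimes>) ys \<one>)) ` {ys. subseq ys xs}"
  have "{ys. subseq ys xs} = set (subseqs xs)" by auto
  then have "finite P" unfolding P_def by simp
  then obtain g where g: "g \<in> Units G" "g \<notin> P"
    using assms by (meson finite_subset subsetI)
  have "foldr (\<otimes>) ys \<one> \<noteq> \<one>" if ys: "subseq ys (g # xs)" "ys \<noteq> []" for ys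
  proof (cases "subseq ys xs")
    case False
    then obtain zs where zs: "ys = g # zs" "subseq zs xs"
      using ys by (cases ys) (auto split: if_splits)
    have Z: "foldr (\<otimes>) zs \<one> \<in> Units G"
      using subseq_set[OF zs(2)] xs(1) foldr_mult_Units by blast
    show ?thesis
    proof
      assume "foldr (\<otimes>) ys \<one> = \<one>"
      then have "g \<otimes> foldr (\<otimes>) zs \<one> = \<one>" using zs by simp
      then have "g = inv (foldr (\<otimes>) zs \<one>)"
        using Z g(1) by (metis Units_closed Units_r_inv Units_inv_Units inv_unique Units_l_inv)
      with g(2) zs(2) show False unfolding P_def by blast
    qed
  qed (use xs(3) ys in auto)
  with xs(1,2) g(1) show ?case by (intro exI[of _ "g # xs"]) auto
qed

text \<open>Subproducts of units are units, so an idempotent one equals \<open>\<one>\<close>, which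
  a sequence without subproduct \<open>\<one>\<close> does not have.\<close>

lemma (in monoid) finite_Units_if_erdos_burgess:
  assumes "erdos_burgess_length G l"
  shows "finite (Units G)"
proof (rule ccontr)
  assume "infinite (Units G)"
  then obtain xs where xs: "set xs \<subseteq> Units G" "length xs = l"
      "\<And>ys. subseq ys xs \<Longrightarrow> ys \<noteq> [] \<Longrightarrow> foldr (\<otimes>) ys \<one> \<noteq> \<one>"
    using infinite_Units_product_one_free[of l] by blast
  then obtain ys where ys: "ys \<noteq> []" "subseq ys xs" "idempotent_elem G (foldr (\<otimes>) ys \<one>)"
    using erdos_burgess_lengthE[OF assms, of xs] Units_closed by blast
  have "foldr (\<otimes>) ys \<one> \<in> Units G"
    using subseq_set[OF ys(2)] xs(1) foldr_mult_Units by blast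
  with ys xs(3) unit_idempotent_eq_one show False by blast
qed

section \<open>Maximal ideals and the Jacobson radical\<close>

lemma (in ring) ideal_minus_closed:
  assumes "ideal I R" "a \<in> I" "b \<in> I"
  shows "a \<ominus> b \<in> I"
  using assms by (metis a_minus_def additive_subgroup.a_closed additive_subgroup.a_inv_closed ideal.axioms(1))

text \<open>Zorn's lemma on the ideals above \<open>I\<close> that avoid \<open>\<one>\<close>:
  unions of nonempty chains are again of this kind, and properness is the same as avoiding
  \<open>\<one>\<close>.\<close>

lemma (in cring) exists_maximalideal:
  assumes "ideal I R" "\<one> \<notin> I"
  obtains M where "maximalideal M R" "I \<subseteq> M"
proof -
  define A where "A = {J. ideal J R \<and> I \<subseteq> J \<and> \<one> \<notin> J}"
  have "\<Union>C \<in> A" if C: "C \<noteq> {}" "subset.chain A C" for C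
  proof -
    have "subset.chain {J. ideal J R} C"
      using C(2) unfolding A_def pred_on.chain_def by blast
    from chain_Union_is_ideal[OF this] C show ?thesis
      unfolding A_def pred_on.chain_def by auto
  qed
  moreover have "A \<noteq> {}" using assms unfolding A_def by blast
  ultimately obtain M where M: "M \<in> A" "\<And>Y. Y \<in> A \<Longrightarrow> M \<subseteq> Y \<Longrightarrow> Y = M"
    using subset_Zorn_nonempty[of A] by blast
  have "maximalideal M R"
  proof (rule maximalidealI)
    show "ideal M R" "carrier R \<noteq> M" using M(1) unfolding A_def by auto
    show "J = M \<or> J = carrier R" if "ideal J R" "M \<subseteq> J" "J \<subseteq> carrier R" for J
      using that M ideal.one_imp_carrier unfolding A_def by blast
  qed
  with M(1) show ?thesis using that unfolding A_def by blast
qed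

text \<open>If \<open>\<one> \<oplus> x\<close> is not a unit, it generates a proper ideal; a
  maximal ideal above that also contains \<open>x\<close>, hence \<open>\<one>\<close>.\<close>

lemma (in cring) one_plus_jacobson_radical_Units:
  assumes "x \<in> jacobson_radical R"
  shows "\<one> \<oplus> x \<in> Units R"
proof (rule ccontr)
  have x: "x \<in> carrier R" using assms unfolding jacobson_radical_def by blast
  assume non_unit: "\<one> \<oplus> x \<notin> Units R"
  have "\<one> \<notin> PIdl (\<one> \<oplus> x)"
  proof
    assume "\<one> \<in> PIdl (\<one> \<oplus> x)"
    then obtain y where "y \<in> carrier R" "\<one> = y \<otimes> (\<one> \<oplus> x)"
      unfolding cgenideal_def by blast
    then show False
      using non_unit x m_comm unfolding Units_def by auto
  qed
  then obtain M where M: "maximalideal M R" "PIdl (\<one> \<oplus> x) \<subseteq> M"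
    using exists_maximalideal cgenideal_ideal x by (metis a_closed one_closed)
  interpret maximalideal M R by (rule M(1))
  have "\<one> \<oplus> x \<in> M" using M(2) cgenideal_self x by blast
  moreover have "x \<in> M" using assms M(1) unfolding jacobson_radical_def by blast
  ultimately have "(\<one> \<oplus> x) \<ominus> x \<in> M" using ideal_minus_closed is_ideal by blast
  moreover have "(\<one> \<oplus> x) \<ominus> x = \<one>" using x by algebra
  ultimately show False using one_imp_carrier I_notcarr by auto
qed

lemma (in cring) finite_jacobson_radical:
  assumes "finite (Units R)"
  shows "finite (jacobson_radical R)"
proof (rule inj_on_finite[OF _ _ assms])
  show "inj_on (\<lambda>x. \<one> \<oplus> x) (jacobson_radical R)"
    unfolding inj_on_def jacobson_radical_def by auto
  show "(\<lambda>x. \<one> \<oplus> x) ` jacobson_radical R \<subseteq> Units R"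
    using one_plus_jacobson_radical_Units by blast
qed

section \<open>Comaximality and the Chinese remainder theorem\<close>

lemma (in cring) maximalideal_add_carrier:
  assumes "maximalideal M R" "ideal I R" "\<not> I \<subseteq> M"
  shows "I <+>\<^bsub>R\<^esub> M = carrier R"
proof -
  interpret maximalideal M R by (rule assms(1))
  have id: "ideal (I <+>\<^bsub>R\<^esub> M) R" using add_ideals assms(2) is_ideal by blast
  have "M \<subseteq> I <+>\<^bsub>R\<^esub> M"
  proof
    fix m assume m: "m \<in> M"
    have "\<zero> \<in> I" using assms(2) additive_subgroup.zero_closed ideal.axioms(1) by metis
    moreover have "m = \<zero> \<oplus> m" using m Icarr by simp
    ultimately show "m \<in> I <+>\<^bsub>R\<^esub> M" using m unfolding set_add_def' by blast
  qed
  moreover have "I \<subseteq> I <+>\<^bsub>R\<^esub> M"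
  proof
    fix i assume i: "i \<in> I"
    have "i = i \<oplus> \<zero>" using i ideal.Icarr[OF assms(2)] by simp
    then show "i \<in> I <+>\<^bsub>R\<^esub> M" using i zero_closed unfolding set_add_def' by blast
  qed
  ultimately show ?thesis
    using I_maximal[OF id] assms(3) ideal.Icarr[OF id] by blast
qed

text \<open>The intersection with \<open>carrier R\<close> covers the empty family, for which
  \<open>\<Inter>A\<close> alone is the whole type.\<close>

lemma (in cring) Inter_ideals_ideal:
  assumes "\<And>I. I \<in> A \<Longrightarrow> ideal I R"
  shows "ideal (carrier R \<inter> \<Inter>A) R"
proof (cases "A = {}")
  case False
  with assms show ?thesis by (simp add: i_Intersect i_intersect oneideal)
qed (simp add: oneideal)

text \<open>Multiply elements outside \<open>I\<close>, one from each member of \<open>A\<close>: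
  the product lies in every member and, by primality, not in \<open>I\<close>.\<close>

lemma (in primeideal) Inter_not_subset:
  assumes "finite A" "\<And>J. J \<in> A \<Longrightarrow> ideal J R \<and> \<not> J \<subseteq> I"
  shows "\<not> carrier R \<inter> \<Inter>A \<subseteq> I"
  using assms
proof (induction A rule: finite_induct)
  case empty
  then show ?case using I_notcarr a_subset by auto
next
  case (insert J A)
  then have J: "ideal J R" "\<not> J \<subseteq> I" by simp_all
  have "\<not> carrier R \<inter> \<Inter>A \<subseteq> I" using insert.IH insert.prems by simp
  with J(2) obtain a b where ab: "a \<in> carrier R" "a \<in> \<Inter>A" "a \<notin> I" "b \<in> J" "b \<notin> I"
    by blast
  have b: "b \<in> carrier R" using ideal.Icarr[OF J(1) ab(4)] .
  have "a \<otimes> b \<in> J" using ideal.I_l_closed[OF J(1)] ab by blast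
  moreover have "a \<otimes> b \<in> \<Inter>A"
  proof
    fix J' assume "J' \<in> A"
    then show "a \<otimes> b \<in> J'" using ideal.I_r_closed[of J' R a b] insert.prems ab(2) b by auto
  qed
  moreover have "a \<otimes> b \<notin> I" using I_prime ab b by blast
  ultimately show ?case using ab b by blast
qed

lemma maximalideal_not_subset:
  assumes "maximalideal M R" "maximalideal N R" "M \<noteq> N"
  shows "\<not> M \<subseteq> N"
  using assms maximalideal.I_maximal[OF assms(1), of N] maximalideal.I_notcarr[OF assms(2)]
    maximalideal.axioms(1)[OF assms(2)] ideal.Icarr[of N R] by blast

text \<open>Induction with the two-factor Chinese remainder theorem: the head is comaximal to the
  intersection of the others, since a prime ideal containing a finite intersection of ideals
  contains one of them. The empty list gives the zero ring on both sides.\<close>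

lemma (in cring) FactRing_Inter_iso_RDirProd_list:
  assumes "distinct Ms" "\<And>M. M \<in> set Ms \<Longrightarrow> maximalideal M R"
  shows "R Quot (carrier R \<inter> \<Inter>(set Ms)) \<simeq> RDirProd_list (map (\<lambda>M. R Quot M) Ms)"
  using assms
proof (induction Ms)
  case Nil
  have "(\<lambda>_. []) \<in> ring_iso (R Quot carrier R) nil_ring"
  proof (rule ring_iso_memI)
    have "carrier (R Quot carrier R) = {carrier R}"
      unfolding FactRing_def A_RCOSETS_def'
      using a_rcos_zero[OF oneideal] by auto
    then show "bij_betw (\<lambda>_. []) (carrier (R Quot carrier R)) (carrier nil_ring)"
      by (simp add: bij_betw_def)
  qed (auto simp: monoid.defs)
  then show ?case unfolding is_ring_iso_def by auto
next
  case (Cons M Ms)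
  define I where "I = carrier R \<inter> \<Inter>(set Ms)"
  have M: "maximalideal M R" using Cons.prems by simp
  have id: "ideal M R" "ideal I R"
    unfolding I_def using maximalideal.axioms(1)[OF M] Cons.prems(2)
    by (simp, intro Inter_ideals_ideal maximalideal.axioms(1)) simp
  have Mc: "M \<subseteq> carrier R" using ideal.Icarr[OF id(1)] by blast
  have "\<not> I \<subseteq> M" unfolding I_def
  proof (intro primeideal.Inter_not_subset maximalideal_prime[OF M])
    fix J assume J: "J \<in> set Ms"
    then have "maximalideal J R" "J \<noteq> M" using Cons.prems by auto
    then show "ideal J R \<and> \<not> J \<subseteq> M"
      using maximalideal_not_subset[OF _ M] maximalideal.axioms(1) by blast
  qed simp
  then have "M <+>\<^bsub>R\<^esub> I = carrier R"
    using maximalideal_add_carrier[OF M id(2)] set_add_comm Mc unfolding I_def by auto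
  then have 1: "R Quot (M \<inter> I) \<simeq> RDirProd (R Quot M) (R Quot I)"
    using chinese_remainder_simple id by blast
  have "R Quot I \<simeq> RDirProd_list (map (\<lambda>M. R Quot M) Ms)"
    unfolding I_def using Cons by simp
  then have 2: "RDirProd (R Quot M) (R Quot I) \<simeq>
      RDirProd (R Quot M) (RDirProd_list (map (\<lambda>M. R Quot M) Ms))"
    unfolding is_ring_iso_def using RDirProd_iso5 by blast
  have 3: "RDirProd (R Quot M) (RDirProd_list (map (\<lambda>M. R Quot M) Ms)) \<simeq>
      RDirProd_list (map (\<lambda>M. R Quot M) (M # Ms))"
    unfolding is_ring_iso_def using RDirProd_list_iso1 by auto
  have "carrier R \<inter> \<Inter>(set (M # Ms)) = M \<inter> I" unfolding I_def using Mc by auto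
  with 1 2 3 show ?case using ring_iso_trans by metis
qed

section \<open>Finite fields have prime power order\<close>

text \<open>For a prime \<open>q \<noteq> p\<close> dividing the order, the elements of a Sylow
  \<open>q\<close>-subgroup would have order dividing both \<open>p\<close> and a power of
  \<open>q\<close>, so that subgroup would be trivial.\<close>

lemma (in group) order_prime_power_if_prime_exponent:
  assumes "finite (carrier G)" "Factorial_Ring.prime (p::nat)"
    and "\<And>x. x \<in> carrier G \<Longrightarrow> x [^] p = \<one>"
  shows "\<exists>k. order G = p ^ k"
proof -
  have pos: "order G \<noteq> 0" using assms(1) order_gt_0_iff_finite by simp
  have "q = p" if q: "Factorial_Ring.prime q" "q dvd order G" for q
  proof (rule ccontr)
    assume "q \<noteq> p"
    obtain m where m: "order G = q ^ multiplicity q (order G) * m"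
      using multiplicity_dvd by blast
    have mult: "multiplicity q (order G) > 0"
      using q pos by (simp add: prime_multiplicity_gt_zero_iff)
    obtain H where H: "subgroup H G" "card H = q ^ multiplicity q (order G)"
      using sylow_thm[OF q(1) is_group m assms(1)] by blast
    interpret H: group "G\<lparr>carrier := H\<rparr>" using H(1) by (rule subgroup_imp_group)
    have "h = \<one>" if h: "h \<in> H" for h
    proof -
      have hG: "h \<in> carrier G" using H(1) h subgroup.mem_carrier by metis
      have "h [^]\<^bsub>G\<lparr>carrier := H\<rparr>\<^esub> card H = \<one>"
        using H.pow_order_eq_1 h by (simp add: order_def)
      then have "h [^] card H = \<one>"
        using nat_pow_consistent by metis
      then have "ord h dvd q ^ multiplicity q (order G)"
        using pow_eq_id[OF hG] H(2) by simp
      moreover have "ord h dvd p" using pow_eq_id[OF hG] assms(3)[OF hG] by simp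
      moreover have "coprime p (q ^ multiplicity q (order G))"
        using \<open>q \<noteq> p\<close> q(1) assms(2) primes_coprime by auto
      ultimately have "ord h = 1" by (meson coprime_common_divisor_nat coprime_def nat_dvd_1_iff_1)
      then show ?thesis using ord_eq_1 hG by blast
    qed
    then have "H \<subseteq> {\<one>}" by blast
    then have "card H \<le> 1" using card_mono[of "{\<one>}" H] by simp
    moreover have "q ^ multiplicity q (order G) > 1"
      using one_less_power[OF _ mult] prime_gt_1_nat[OF q(1)] by blast
    ultimately show False using H(2) by linarith
  qed
  then have "prime_factors (order G) \<subseteq> {p}" using pos by (auto simp: in_prime_factors_iff)
  moreover have "order G = (\<Prod>q\<in>prime_factors (order G). q ^ multiplicity q (order G))"
    using pos by (simp add: prime_factorization_nat)
  ultimately show ?thesis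
    by (metis (no_types, lifting) power_0 prod.empty prod.insert finite.emptyI empty_iff mult_1_right subset_singletonD)
qed

text \<open>Let \<open>n = p * m\<close> be the additive order of \<open>\<one>\<close>, with
  \<open>p\<close> prime. The product of \<open>[p] \<cdot> \<one>\<close> and
  \<open>[m] \<cdot> \<one>\<close> vanishes and the second factor does not, so \<open>p\<close>
  annihilates the additive group.\<close>

lemma (in field) finite_imp_primepow_order:
  assumes "finite (carrier R)"
  shows "primepow (order R)"
proof -
  have A: "group (add_monoid R)" by (rule a_group)
  define n where "n = group.ord (add_monoid R) \<one>"
  have "n \<noteq> 0" "n \<noteq> 1"
    unfolding n_def using group.ord_ge_1[OF A, of \<one>] group.ord_eq_1[OF A, of \<one>] assms by auto
  then obtain p where p: "Factorial_Ring.prime p" "p dvd n" using prime_factor_nat by blast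
  then obtain m where m: "n = p * m" by blast
  have "m < n" "0 < m" using m \<open>n \<noteq> 0\<close> prime_gt_1_nat[OF p(1)] by auto
  have eq_zero: "[k] \<cdot> \<one> = \<zero> \<longleftrightarrow> n dvd k" for k :: nat
    unfolding n_def add_pow_def using group.pow_eq_id[OF A, of \<one>] by simp
  have "([p] \<cdot> \<one>) \<otimes> ([m] \<cdot> \<one>) = [p] \<cdot> ([m] \<cdot> \<one>)"
    using add_pow_ldistr[of \<one> "[m] \<cdot> \<one>" p] by simp
  also have "\<dots> = [n] \<cdot> \<one>" using add.nat_pow_pow[of \<one> p m] by (simp add: m mult.commute)
  also have "\<dots> = \<zero>" by (simp only: eq_zero dvd_refl)
  finally have "[p] \<cdot> \<one> = \<zero> \<or> [m] \<cdot> \<one> = \<zero>" by (rule integral) (rule add.nat_pow_closed[OF one_closed])+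
  moreover have "[m] \<cdot> \<one> \<noteq> \<zero>" unfolding eq_zero using \<open>m < n\<close> \<open>0 < m\<close> by (rule nat_dvd_not_less[rotated])
  ultimately have "[p] \<cdot> \<one> = \<zero>" by blast
  then have "x [^]\<^bsub>add_monoid R\<^esub> p = \<one>\<^bsub>add_monoid R\<^esub>" if "x \<in> carrier R" for x
    using add_pow_ldistr[of \<one> x p] that unfolding add_pow_def by simp
  then obtain k where k: "order R = p ^ k"
    using group.order_prime_power_if_prime_exponent[OF A _ p(1)] assms by (auto simp: order_def)
  \<comment> \<open>Excludes the exponent 0, which \<open>primepow\<close> does not admit.\<close>
  have "order R \<noteq> 1"
    using one_not_zero unfolding order_def by (metis card_1_singletonE one_closed zero_closed singletonD)
  with k have "k > 0" by (cases k) auto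
  then show ?thesis using k p(1) unfolding primepow_def by blast
qed

section \<open>The two kinds of maximal ideals\<close>

text \<open>The element \<open>w\<close> is a third residue modulo \<open>M\<close>; unlike \<open>order (R Quot M) > 2\<close>, this also
  covers infinite residue fields, whose \<^const>\<open>order\<close> is 0.\<close>
definition large_maximalideals :: "('a, 'm) ring_scheme \<Rightarrow> 'a set set"
  where "large_maximalideals R =
    {M. maximalideal M R \<and> (\<exists>w \<in> carrier R. w \<notin> M \<and> \<one>\<^bsub>R\<^esub> \<ominus>\<^bsub>R\<^esub> w \<notin> M)}"

text \<open>The ideal \<open>K\<close> of the overview: a maximal ideal that is not large has
  exactly the residues 0 and 1. If there is none, the value is \<open>carrier R\<close>.\<close>

definition binary_radical :: "('a, 'm) ring_scheme \<Rightarrow> 'a set"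
  where "binary_radical R = carrier R \<inter> \<Inter>{M. maximalideal M R \<and> M \<notin> large_maximalideals R}"

lemma (in cring) jacobson_radical_eq:
  "jacobson_radical R = binary_radical R \<inter> (carrier R \<inter> \<Inter>(large_maximalideals R))"
  unfolding jacobson_radical_def binary_radical_def large_maximalideals_def by blast

section \<open>Residues modulo prime and maximal ideals\<close>

lemma carrier_FactRing: "carrier (R Quot I) = (\<lambda>a. I +>\<^bsub>R\<^esub> a) ` carrier R"
  unfolding FactRing_def A_RCOSETS_def' by auto

lemma (in primeideal) pow_mem:
  assumes "x \<in> carrier R" "x [^] (k::nat) \<in> I"
  shows "x \<in> I"
  using assms(2)
proof (induction k)
  case 0
  then show ?case using one_imp_carrier I_notcarr by simp
next
  case (Suc k)
  then show ?case using I_prime[of "x [^] k" x] assms(1) by auto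
qed

lemma (in primeideal) idempotent_cases:
  assumes "idempotent_elem R e"
  shows "e \<in> I \<or> \<one> \<ominus> e \<in> I"
proof -
  have e: "e \<in> carrier R" "e \<otimes> e = e" using assms unfolding idempotent_elem_def by auto
  have "e \<otimes> (\<one> \<ominus> e) = e \<ominus> e \<otimes> e" using e(1) by algebra
  also have "\<dots> = \<zero>" using e by simp
  finally have "e \<otimes> (\<one> \<ominus> e) \<in> I" by simp
  then show ?thesis using I_prime e(1) by blast
qed

text \<open>If \<open>x\<^sup>k = e\<close> is idempotent, then \<open>x\<close> acts invertibly on \<open>eR\<close>, so that
  \<open>x e + (1 - e)\<close> is a unit; it is congruent to \<open>x\<close> modulo every prime that avoids \<open>x\<close>.\<close>
lemma (in primeideal) unit_congruent:
  assumes "erdos_burgess_length R l" "x \<in> carrier R" "x \<notin> I"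
  obtains u where "u \<in> Units R" "u \<ominus> x \<in> I"
proof -
  obtain k where k: "0 < k" "idempotent_elem R (x [^] (k::nat))"
    using erdos_burgess_idempotent_pow assms by blast
  define e where "e = x [^] k"
  define y where "y = x [^] (k - 1)"
  have y: "y \<in> carrier R" unfolding y_def using assms(2) by simp
  have e: "e \<in> carrier R" "e \<otimes> e = e" using k(2) unfolding e_def idempotent_elem_def by auto
  have xy: "x \<otimes> y = e"
    unfolding e_def y_def using nat_pow_Suc2[OF assms(2), of "k - 1"] k(1) by simp
  define u where "u = x \<otimes> e \<oplus> (\<one> \<ominus> e)"
  \<comment> \<open>\<open>v\<close> is the inverse of \<open>u\<close>: on the part cut out by
    \<open>e\<close>, the inverse of \<open>x\<close> is \<open>y\<close>, because
    \<open>x \<otimes> y = e\<close>.\<close>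
  define v where "v = y \<otimes> e \<oplus> (\<one> \<ominus> e)"
  have uv: "u \<in> carrier R" "v \<in> carrier R" unfolding u_def v_def using assms(2) y e(1) by auto
  \<comment> \<open>Grouped so that \<open>x \<otimes> y\<close> and \<open>e \<otimes> e\<close>
    occur literally and can be replaced by \<open>e\<close>.\<close>
  have "u \<otimes> v = (x \<otimes> y) \<otimes> (e \<otimes> e) \<oplus> (x \<oplus> y) \<otimes> (e \<ominus> e \<otimes> e) \<oplus> (\<one> \<ominus> e \<ominus> e \<oplus> e \<otimes> e)"
    unfolding u_def v_def using assms(2) y e(1) by algebra
  also have "\<dots> = e \<oplus> (x \<oplus> y) \<otimes> (e \<ominus> e) \<oplus> (\<one> \<ominus> e \<ominus> e \<oplus> e)" unfolding xy e(2) ..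
  also have "\<dots> = \<one>" using assms(2) y e(1) by algebra
  finally have "u \<in> Units R" using uv m_comm[OF uv] unfolding Units_def by auto
  moreover have "u \<ominus> x \<in> I"
  proof -
    have "e \<notin> I" using pow_mem assms(2,3) unfolding e_def by blast
    then have "\<one> \<ominus> e \<in> I" using idempotent_cases k(2) unfolding e_def by blast
    then have "(\<one> \<ominus> e) \<otimes> (\<one> \<ominus> x) \<in> I" using I_r_closed assms(2) by simp
    moreover have "u \<ominus> x = (\<one> \<ominus> e) \<otimes> (\<one> \<ominus> x)"
      unfolding u_def using assms(2) e(1) by algebra
    ultimately show ?thesis by simp
  qed
  ultimately show ?thesis using that by blast
qed

text \<open>The cosets of zero and of the finitely many units exhaust the quotient, as every element
  outside \<open>I\<close> is congruent to a unit.\<close>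

lemma (in primeideal) finite_FactRing:
  assumes "erdos_burgess_length R l"
  shows "finite (carrier (R Quot I))"
proof (rule finite_subset)
  show "carrier (R Quot I) \<subseteq> (\<lambda>a. I +> a) ` insert \<zero> (Units R)"
  proof
    fix c assume "c \<in> carrier (R Quot I)"
    then obtain x where x: "c = I +> x" "x \<in> carrier R" unfolding carrier_FactRing by blast
    show "c \<in> (\<lambda>a. I +> a) ` insert \<zero> (Units R)"
    proof (cases "x \<in> I")
      case True
      then have "I +> x = I +> \<zero>" using a_rcos_zero[OF is_ideal] by simp
      then show ?thesis unfolding x(1) by (intro image_eqI[of _ _ \<zero>]) simp_all
    next
      case False
      then obtain u where u: "u \<in> Units R" "u \<ominus> x \<in> I" using unit_congruent assms x(2) by blast
      then have "I +> u = I +> x" using quotient_eq_iff_same_a_r_cos[OF is_ideal _ x(2)] Units_closed by blast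
      then show ?thesis unfolding x(1) using u(1) by (intro image_eqI[of _ _ u]) simp_all
    qed
  qed
qed (simp add: finite_Units_if_erdos_burgess[OF assms])

text \<open>Zero, one and the witness \<open>w\<close> lie in distinct cosets. Finiteness matters
  because an infinite carrier has \<open>order\<close> 0.\<close>

lemma (in cring) order_FactRing_large:
  assumes "M \<in> large_maximalideals R" "finite (carrier (R Quot M))"
  shows "order (R Quot M) > 2"
proof -
  obtain w where w: "w \<in> carrier R" "w \<notin> M" "\<one> \<ominus> w \<notin> M" and M: "maximalideal M R"
    using assms(1) unfolding large_maximalideals_def by blast
  interpret maximalideal M R by (rule M)
  have "\<one> \<notin> M" using one_imp_carrier I_notcarr by blast
  then have "M +> \<one> \<noteq> M +> \<zero>" "M +> w \<noteq> M +> \<zero>" "M +> \<one> \<noteq> M +> w"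
    using w by (simp_all add: quotient_eq_iff_same_a_r_cos[OF is_ideal, symmetric] a_minus_def)
  then have "card {M +> \<zero>, M +> \<one>, M +> w} = 3" by auto
  moreover have "{M +> \<zero>, M +> \<one>, M +> w} \<subseteq> carrier (R Quot M)"
    unfolding carrier_FactRing using w(1) by (simp add: image_eqI)
  then have "card {M +> \<zero>, M +> \<one>, M +> w} \<le> order (R Quot M)"
    unfolding order_def by (rule card_mono[OF assms(2)])
  ultimately show ?thesis by simp
qed

section \<open>Bounding the number of large maximal ideals\<close>

text \<open>By comaximality some \<open>a\<close> is 1 modulo \<open>M\<close> and lies in all other
  members of \<open>S\<close>; it serves to interpolate between the residue of \<open>w\<close> at
  \<open>M\<close> and the residue 1 elsewhere.\<close>

lemma (in cring) exists_separating_element: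
  assumes S: "finite S" "S \<subseteq> large_maximalideals R" and M: "M \<in> S"
  shows "\<exists>x \<in> carrier R. x \<notin> M \<and> \<one> \<ominus> x \<notin> M \<and> (\<forall>N \<in> S - {M}. \<one> \<ominus> x \<in> N)"
proof -
  obtain w where w: "w \<in> carrier R" "w \<notin> M" "\<one> \<ominus> w \<notin> M" and max: "maximalideal M R"
    using M S(2) unfolding large_maximalideals_def by blast
  interpret primeideal M R by (rule maximalideal_prime[OF max])
  define I where "I = carrier R \<inter> \<Inter>(S - {M})"
  have N: "maximalideal N R" if "N \<in> S" for N
    using that S(2) unfolding large_maximalideals_def by blast
  have "ideal I R" unfolding I_def using N maximalideal.axioms(1)
    by (metis (no_types, lifting) DiffD1 Inter_ideals_ideal)
  moreover have "\<not> I \<subseteq> M" unfolding I_def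
  proof (rule Inter_not_subset)
    fix J assume "J \<in> S - {M}"
    then show "ideal J R \<and> \<not> J \<subseteq> M"
      using N[of J] maximalideal_not_subset[OF _ max, of J] maximalideal.axioms(1)[of J R] by blast
  qed (use S(1) in simp)
  ultimately have "I <+>\<^bsub>R\<^esub> M = carrier R" using maximalideal_add_carrier[OF max] by blast
  then obtain a b where ab: "a \<in> I" "b \<in> M" "\<one> = a \<oplus> b"
    using one_closed unfolding set_add_def' by blast
  have carr: "a \<in> carrier R" "b \<in> carrier R" using ab(1,2) unfolding I_def by auto
  have b: "b = \<one> \<ominus> a" unfolding ab(3) using carr by algebra
  have "a \<notin> M"
  proof
    assume "a \<in> M"
    then have "\<one> \<in> M" using ab by simp
    then show False using one_imp_carrier I_notcarr by blast
  qed
  \<comment> \<open>Congruent to \<open>w\<close> modulo \<open>M\<close>, where \<open>a\<close> is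
    1, and to 1 modulo the other ideals, where \<open>a\<close> is 0.\<close>
  define x where "x = \<one> \<ominus> a \<otimes> (\<one> \<ominus> w)"
  have x: "x \<in> carrier R" "\<one> \<ominus> x = a \<otimes> (\<one> \<ominus> w)"
    unfolding x_def using w(1) carr by (simp, algebra)
  have "\<one> \<ominus> x \<notin> M" unfolding x(2) using I_prime[of a "\<one> \<ominus> w"] \<open>a \<notin> M\<close> w carr by auto
  moreover have "x \<notin> M"
  proof
    assume "x \<in> M"
    moreover have "x \<ominus> b = a \<otimes> w" unfolding x_def b using w(1) carr by algebra
    ultimately have "a \<otimes> w \<in> M" using ideal_minus_closed[OF is_ideal] ab(2) by metis
    then show False using I_prime[of a w] \<open>a \<notin> M\<close> w carr by blast
  qed
  moreover have "\<one> \<ominus> x \<in> N" if "N \<in> S - {M}" for N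
  proof -
    have "ideal N R" using N that maximalideal.axioms(1) by blast
    moreover have "a \<in> N" using ab(1) that unfolding I_def by blast
    ultimately show ?thesis unfolding x(2) using ideal.I_r_closed w(1) by (metis minus_closed one_closed)
  qed
  ultimately show ?thesis using x(1) by blast
qed

text \<open>The induction rests on \<open>\<one> \<ominus> x \<otimes> p = (\<one> \<ominus> p)
  \<oplus> (\<one> \<ominus> x) \<otimes> p\<close>.\<close>

lemma (in ideal) foldr_mult_congruent_one:
  assumes "set xs \<subseteq> carrier R" "\<And>x. x \<in> set xs \<Longrightarrow> \<one> \<ominus> x \<in> I"
  shows "\<one> \<ominus> foldr (\<otimes>) xs \<one> \<in> I"
  using assms
proof (induction xs)
  case Nil
  then show ?case by (simp add: a_minus_def r_neg)
next
  case (Cons x xs)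
  define p where "p = foldr (\<otimes>) xs \<one>"
  have carr: "x \<in> carrier R" "p \<in> carrier R" unfolding p_def using Cons.prems foldr_mult_closed by auto
  have "(\<one> \<ominus> p) \<oplus> (\<one> \<ominus> x) \<otimes> p \<in> I"
    unfolding p_def using Cons carr(2) p_def by (auto intro!: a_closed I_r_closed)
  moreover have "(\<one> \<ominus> p) \<oplus> (\<one> \<ominus> x) \<otimes> p = \<one> \<ominus> x \<otimes> p"
    using carr by (simp add: a_minus_def l_distr l_minus a_assoc r_neg2 r_neg1)
  ultimately show ?case unfolding p_def by simp
qed

text \<open>The witness is a sequence with one term \<open>x M\<close> per ideal \<open>M\<close>, where \<open>x M\<close> is neither
  0 nor 1 modulo \<open>M\<close> and is 1 modulo the others: modulo \<open>M\<close>, a product that involves \<open>x M\<close>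
  is congruent to \<open>x M\<close>.\<close>
lemma (in cring) card_large_maximalideals_neq:
  assumes l: "erdos_burgess_length R l" and S: "finite S" "S \<subseteq> large_maximalideals R"
  shows "card S \<noteq> l"
proof
  assume "card S = l"
  obtain Ms where Ms: "set Ms = S" "distinct Ms" using finite_distinct_list S(1) by blast
  have "\<exists>x. \<forall>M \<in> S. x M \<in> carrier R \<and> x M \<notin> M \<and> \<one> \<ominus> x M \<notin> M \<and>
      (\<forall>N \<in> S - {M}. \<one> \<ominus> x M \<in> N)"
    using exists_separating_element[OF S] by (intro bchoice) blast
  then obtain x where x: "\<And>M. M \<in> S \<Longrightarrow> x M \<in> carrier R" "\<And>M. M \<in> S \<Longrightarrow> x M \<notin> M"
      "\<And>M. M \<in> S \<Longrightarrow> \<one> \<ominus> x M \<notin> M" "\<And>M N. M \<in> S \<Longrightarrow> N \<in> S - {M} \<Longrightarrow> \<one> \<ominus> x M \<in> N"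
    by metis
  have "set (map x Ms) \<subseteq> carrier R" "length (map x Ms) = l"
    using x(1) Ms \<open>card S = l\<close> distinct_card[OF Ms(2)] by auto
  then obtain ys where ys: "ys \<noteq> []" "subseq ys (map x Ms)" "idempotent_elem R (foldr (\<otimes>) ys \<one>)"
    using erdos_burgess_lengthE[OF l] by metis
  then obtain A where "ys = nths (map x Ms) A" by (auto simp: subseq_conv_nths)
  \<comment> \<open>The subsequence is indexed by a sublist of the distinct list \<open>Ms\<close>,
    so its head \<open>M\<close> occurs once and all later factors are 1 modulo
    \<open>M\<close>.\<close>
  then have "ys = map x (nths Ms A)" by (simp add: nths_map)
  then obtain M Ns where Ns: "nths Ms A = M # Ns" "ys = x M # map x Ns"
    using ys(1) by (cases "nths Ms A") auto
  have "distinct (M # Ns)" "set (M # Ns) \<subseteq> S"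
    using Ms distinct_nthsI set_nths_subset Ns(1) by metis+
  then have M: "M \<in> S" "set Ns \<subseteq> S - {M}" by auto
  interpret primeideal M R
    using M(1) S(2) maximalideal_prime unfolding large_maximalideals_def by blast
  define q where "q = foldr (\<otimes>) (map x Ns) \<one>"
  have "set (map x Ns) \<subseteq> carrier R" using x(1) M(2) by auto
  then have q: "q \<in> carrier R" "\<one> \<ominus> q \<in> M"
    unfolding q_def using foldr_mult_closed foldr_mult_congruent_one[of "map x Ns"] x(4) M by auto
  have prod: "idempotent_elem R (x M \<otimes> q)" using ys(3) unfolding Ns(2) q_def by simp
  have "x M \<otimes> (\<one> \<ominus> q) \<in> M" using q x(1) M(1) I_l_closed by blast
  \<comment> \<open>These identities carry the dichotomy for the idempotent
    \<open>x M \<otimes> q\<close> over to \<open>x M\<close>, to which it is congruent modulo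
    \<open>M\<close>.\<close>
  moreover have "x M \<otimes> q \<oplus> x M \<otimes> (\<one> \<ominus> q) = x M"
    "(\<one> \<ominus> x M \<otimes> q) \<ominus> x M \<otimes> (\<one> \<ominus> q) = \<one> \<ominus> x M"
    using x(1)[OF M(1)] q(1) by algebra+
  ultimately have "x M \<in> M \<or> \<one> \<ominus> x M \<in> M"
    using idempotent_cases[OF prod] a_closed ideal_minus_closed[OF is_ideal] by metis
  then show False using x(2,3) M(1) by blast
qed

text \<open>A set of \<open>l\<close> or more large ideals, finite or not, would contain one with
  exactly \<open>l\<close> members, which is impossible.\<close>

lemma (in cring) large_maximalideals_bound:
  assumes "erdos_burgess_length R l"
  shows "finite (large_maximalideals R)" "card (large_maximalideals R) < l"
proof -
  have *: "\<not> l \<le> card S" if "finite S" "S \<subseteq> large_maximalideals R" for S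
  proof
    assume "l \<le> card S"
    then obtain T where "T \<subseteq> S" "card T = l" using obtain_subset_with_card_n by metis
    then show False
      using card_large_maximalideals_neq[OF assms, of T] that finite_subset by blast
  qed
  show "finite (large_maximalideals R)"
  proof (rule ccontr)
    assume "infinite (large_maximalideals R)"
    then obtain T where "T \<subseteq> large_maximalideals R" "finite T" "card T = l"
      using infinite_arbitrarily_large by blast
    then show False using * by auto
  qed
  then show "card (large_maximalideals R) < l" using * by force
qed

section \<open>The Boolean quotient and its comaximality with the large ideals\<close>

lemma (in cring) ideal_binary_radical: "ideal (binary_radical R) R"
  unfolding binary_radical_def using maximalideal.axioms(1) by (intro Inter_ideals_ideal) blast

text \<open>Each maximal ideal that is not large contains \<open>x\<close> or
  \<open>\<one> \<ominus> x\<close>, hence also \<open>x \<otimes> x \<ominus> x\<close>.\<close>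

lemma (in cring) boolean_ring_FactRing_binary_radical:
  "boolean_ring (R Quot binary_radical R)"
proof (rule boolean_ring.intro[OF ideal.quotient_is_ring[OF ideal_binary_radical]], unfold_locales)
  let ?K = "binary_radical R"
  fix c assume c: "c \<in> carrier (R Quot ?K)"
  then obtain x where x: "c = ?K +> x" "x \<in> carrier R" unfolding carrier_FactRing by blast
  have "x \<otimes> x \<ominus> x \<in> M" if M: "maximalideal M R" "M \<notin> large_maximalideals R" for M
  proof -
    interpret maximalideal M R by (rule M(1))
    have "x \<in> M \<or> \<one> \<ominus> x \<in> M" using M x(2) unfolding large_maximalideals_def by blast
    then have "x \<otimes> (\<one> \<ominus> x) \<in> M" using I_l_closed I_r_closed x(2) by (metis minus_closed one_closed)
    then have "\<ominus> (x \<otimes> (\<one> \<ominus> x)) \<in> M" by simp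
    moreover have "\<ominus> (x \<otimes> (\<one> \<ominus> x)) = x \<otimes> x \<ominus> x" using x(2) by algebra
    ultimately show ?thesis by simp
  qed
  then have "x \<otimes> x \<ominus> x \<in> ?K" unfolding binary_radical_def using x(2) by blast
  then have "?K +> (x \<otimes> x) = c" unfolding x(1) using quotient_eq_iff_same_a_r_cos[OF ideal_binary_radical, symmetric] x(2) by simp
  then have "c \<otimes>\<^bsub>R Quot ?K\<^esub> c = c"
    using ring_hom_mult[OF ideal.rcos_ring_hom[OF ideal_binary_radical] x(2) x(2)] x(1) by simp
  with c show "idempotent_elem (R Quot ?K) c" unfolding idempotent_elem_def by blast
qed

text \<open>A unit is congruent to 1 modulo every maximal ideal with residue field of order 2.\<close>
lemma (in cring) binary_radical_not_subset:
  assumes l: "erdos_burgess_length R l" and M: "M \<in> large_maximalideals R"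
  shows "\<not> binary_radical R \<subseteq> M"
proof -
  obtain w where w: "w \<in> carrier R" "w \<notin> M" "\<one> \<ominus> w \<notin> M" and max: "maximalideal M R"
    using M unfolding large_maximalideals_def by blast
  interpret primeideal M R by (rule maximalideal_prime[OF max])
  obtain u where u: "u \<in> Units R" "u \<ominus> w \<in> M" using unit_congruent[OF l w(1,2)] by blast
  have uc: "u \<in> carrier R" using u(1) by (rule Units_closed)
  have "\<one> \<ominus> u \<in> N" if N: "maximalideal N R" "N \<notin> large_maximalideals R" for N
  proof -
    interpret N: maximalideal N R by (rule N(1))
    have "u \<notin> N"
      using N.I_l_closed[of u "inv u"] u(1) N.one_imp_carrier N.I_notcarr by auto
    then show ?thesis using N uc unfolding large_maximalideals_def by blast
  qed
  then have "\<one> \<ominus> u \<in> binary_radical R" unfolding binary_radical_def using uc by blast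
  moreover have "\<one> \<ominus> u \<notin> M"
  proof
    assume "\<one> \<ominus> u \<in> M"
    then have "(\<one> \<ominus> u) \<oplus> (u \<ominus> w) \<in> M" using u(2) by simp
    moreover have "(\<one> \<ominus> u) \<oplus> (u \<ominus> w) = \<one> \<ominus> w" using uc w(1) by algebra
    ultimately show False using w(3) by simp
  qed
  ultimately show ?thesis by blast
qed

text \<open>Otherwise a maximal ideal \<open>N\<close> contains the sum. As it contains the finite
  intersection of the large ideals, it contains one of them by primality and equals it by
  maximality; but no large ideal contains the binary radical.\<close>

lemma (in cring) binary_radical_add_large:
  assumes l: "erdos_burgess_length R l"
  shows "binary_radical R <+>\<^bsub>R\<^esub> (carrier R \<inter> \<Inter>(large_maximalideals R)) = carrier R"
proof (rule ccontr)
  let ?K = "binary_radical R" and ?L = "carrier R \<inter> \<Inter>(large_maximalideals R)"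
  assume neq: "?K <+>\<^bsub>R\<^esub> ?L \<noteq> carrier R"
  have L_ideal: "ideal M R" if "M \<in> large_maximalideals R" for M
    using that maximalideal.axioms(1) unfolding large_maximalideals_def by blast
  then have L: "ideal ?L R" by (rule Inter_ideals_ideal)
  have KL: "ideal (?K <+>\<^bsub>R\<^esub> ?L) R" using add_ideals ideal_binary_radical L by blast
  then obtain N where N: "maximalideal N R" "?K <+>\<^bsub>R\<^esub> ?L \<subseteq> N"
    using exists_maximalideal ideal.one_imp_carrier neq by metis
  have "?L \<subseteq> N"
  proof (rule ccontr)
    assume "\<not> ?L \<subseteq> N"
    then have "\<exists>x\<in>?L. x \<notin> N" by blast
    then obtain x where x: "x \<in> ?L" "x \<notin> N" by blast
    have "x = \<zero> \<oplus> x" "\<zero> \<in> ?K"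
      using x(1) additive_subgroup.zero_closed[OF ideal.axioms(1)[OF ideal_binary_radical]] by auto
    then have "x \<in> ?K <+>\<^bsub>R\<^esub> ?L" unfolding set_add_def' using x(1) by blast
    then show False using N(2) x(2) by blast
  qed
  then obtain M where M: "M \<in> large_maximalideals R" "M \<subseteq> N"
    using primeideal.Inter_not_subset[OF maximalideal_prime[OF N(1)] large_maximalideals_bound(1)[OF l]]
      L_ideal by blast
  then have "M = N"
    using maximalideal_not_subset[OF _ N(1), of M] unfolding large_maximalideals_def by blast
  moreover have "?K \<subseteq> N"
  proof
    fix x assume x: "x \<in> ?K"
    have "x = x \<oplus> \<zero>" using ideal.Icarr[OF ideal_binary_radical x] by simp
    moreover have "\<zero> \<in> ?L" using additive_subgroup.zero_closed[OF ideal.axioms(1)[OF L]] .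
    ultimately have "x \<in> ?K <+>\<^bsub>R\<^esub> ?L" unfolding set_add_def' using x by blast
    then show "x \<in> N" using N(2) by blast
  qed
  ultimately show False using binary_radical_not_subset[OF l M(1)] by blast
qed

section \<open>Finiteness transfer and assembly of the decomposition\<close>

lemma finite_carrier_RDirProd_list:
  assumes "\<And>F. F \<in> set Fs \<Longrightarrow> finite (carrier F)"
  shows "finite (carrier (RDirProd_list Fs))"
  using assms by (induction Fs) (simp_all add: RDirProd_list_carrier)

text \<open>\<open>R\<close> is covered by finitely many cosets, each a translate of the finite
  ideal \<open>I\<close>.\<close>

lemma (in ring) finite_carrier_if_finite_FactRing:
  assumes I: "ideal I R" and fin: "finite I" "finite (carrier (R Quot I))"
  shows "finite (carrier R)"
proof (rule finite_subset)
  show "carrier R \<subseteq> \<Union>(carrier (R Quot I))"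
    using ideal.axioms(1)[OF I] additive_subgroup.zero_closed
    unfolding carrier_FactRing a_r_coset_def' by fastforce
  show "finite (\<Union>(carrier (R Quot I)))"
    using fin by (auto simp: carrier_FactRing a_r_coset_def')
qed

theorem theorem1p1:
  fixes R :: "('a, 'm) ring_scheme"
  assumes "cring R"
    and "erdos_burgess_constant R < \<infinity>"
  shows "finite (carrier R) \<or>
    (finite (jacobson_radical R) \<and>
     (\<exists>(B :: 'a set ring) (Fs :: 'a set ring list).
        boolean_ring B \<and> infinite (carrier B) \<and>
        (\<forall>F \<in> set Fs. field F \<and> finite (carrier F) \<and> primepow (order F) \<and> order F > 2) \<and>
        enat (length Fs) \<le> erdos_burgess_constant R - 1 \<and>
        R Quot (jacobson_radical R) \<simeq> RDirProd B (RDirProd_list Fs)))"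
\<comment> \<open>Swapping the disjuncts leaves the second alternative to be shown for infinite
  \<open>R\<close>.\<close>
proof (subst disj_commute, rule disjCI)
  interpret cring R by (rule assms(1))
  assume inf: "infinite (carrier R)"
  define l where "l = (LEAST l. erdos_burgess_length R l)"
  have ex: "\<exists>l. erdos_burgess_length R l"
    using assms(2) unfolding erdos_burgess_constant_def by (auto split: if_splits)
  then have l: "erdos_burgess_length R l" unfolding l_def by (rule LeastI_ex)
  have const: "erdos_burgess_constant R = enat l"
    unfolding erdos_burgess_constant_def l_def using ex by simp
  let ?J = "jacobson_radical R" and ?K = "binary_radical R"
  let ?L = "carrier R \<inter> \<Inter>(large_maximalideals R)"
  have max: "maximalideal M R" if "M \<in> large_maximalideals R" for M
    using that unfolding large_maximalideals_def by blast
  obtain Ms where Ms: "set Ms = large_maximalideals R" "distinct Ms"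
    using finite_distinct_list large_maximalideals_bound(1)[OF l] by blast
  define Fs where "Fs = map (\<lambda>M. R Quot M) Ms"
  have Fs: "field F \<and> finite (carrier F) \<and> primepow (order F) \<and> order F > 2" if F: "F \<in> set Fs" for F
  proof -
    obtain M where M: "F = R Quot M" "M \<in> large_maximalideals R"
      using F unfolding Fs_def Ms(1)[symmetric] by auto
    have "field F" unfolding M(1) using maximalideal.quotient_is_field max[OF M(2)] is_cring by blast
    moreover have "finite (carrier F)"
      unfolding M(1) using primeideal.finite_FactRing maximalideal_prime max[OF M(2)] l by blast
    ultimately show ?thesis
      using field.finite_imp_primepow_order order_FactRing_large[OF M(2)] M(1) by blast
  qed
  have J_fin: "finite ?J" using finite_jacobson_radical finite_Units_if_erdos_burgess[OF l] by blast
  have L: "ideal ?L R" using max maximalideal.axioms(1) by (intro Inter_ideals_ideal) blast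
  have "R Quot ?J \<simeq> RDirProd (R Quot ?K) (R Quot ?L)"
    unfolding jacobson_radical_eq
    using chinese_remainder_simple[OF ideal_binary_radical L binary_radical_add_large[OF l]] .
  moreover have "R Quot ?L \<simeq> RDirProd_list Fs"
    using FactRing_Inter_iso_RDirProd_list[OF Ms(2)] max Ms(1) unfolding Fs_def by simp
  then have "RDirProd (R Quot ?K) (R Quot ?L) \<simeq> RDirProd (R Quot ?K) (RDirProd_list Fs)"
    unfolding is_ring_iso_def using RDirProd_iso5 by blast
  ultimately have iso: "R Quot ?J \<simeq> RDirProd (R Quot ?K) (RDirProd_list Fs)"
    by (rule ring_iso_trans)
  \<comment> \<open>With a finite Boolean factor the whole product, hence \<open>R Quot ?J\<close>,
    would be finite; as \<open>?J\<close> is finite, so would be \<open>R\<close>.\<close>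
  have "infinite (carrier (R Quot ?K))"
  proof
    assume "finite (carrier (R Quot ?K))"
    then have "finite (carrier (RDirProd (R Quot ?K) (RDirProd_list Fs)))"
      unfolding RDirProd_carrier using Fs
      by (blast intro: finite_cartesian_product finite_carrier_RDirProd_list)
    then have "finite (carrier (R Quot ?J))"
      using iso bij_betw_finite unfolding is_ring_iso_def ring_iso_def by blast
    moreover have "ideal ?J R" unfolding jacobson_radical_eq using i_intersect ideal_binary_radical L .
    ultimately show False using finite_carrier_if_finite_FactRing J_fin inf by blast
  qed
  moreover have "enat (length Fs) \<le> erdos_burgess_constant R - 1"
  proof -
    have "length Fs = card (large_maximalideals R)"
      unfolding Fs_def using Ms distinct_card by fastforce
    \<comment> \<open>The strictness of the bound on the large ideals accounts for the
      \<open>- 1\<close>.\<close>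
    then have "length Fs \<le> l - 1" using large_maximalideals_bound(2)[OF l] by simp
    then show ?thesis unfolding const one_enat_def by simp
  qed
  ultimately show "finite ?J \<and> (\<exists>(B :: 'a set ring) (Fs :: 'a set ring list).
        boolean_ring B \<and> infinite (carrier B) \<and>
        (\<forall>F \<in> set Fs. field F \<and> finite (carrier F) \<and> primepow (order F) \<and> order F > 2) \<and>
        enat (length Fs) \<le> erdos_burgess_constant R - 1 \<and>
        R Quot ?J \<simeq> RDirProd B (RDirProd_list Fs))"
    using J_fin boolean_ring_FactRing_binary_radical Fs iso by blast
qed

end
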